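(* Let $\mathcal A$ be an associative unital $\mathbb K$-algebra, $A,B\in\mathcal A$, and $\alpha,\epsilon\in\mathbb C$ with $\alpha\ne0$ or $\epsilon\ne0$. Let $r,\rho$ be the two roots of $\alpha+\epsilon X-X^2$. Define sequences $(u_n),(v_n)$ by $u_0=0,u_1=1$, $v_0=1,v_1=0$ and $u_{n+2}=\epsilon u_{n+1}+\alpha u_n$, $v_{n+2}=\epsilon v_{n+1}+\alpha v_n$; equivalently $u_n=\frac{\rho^n-r^n}{\rho-r}$, $v_n=\frac{\rho r^n-r\rho^n}{\rho-r}$ if $r\ne\rho$, and $u_n=nr^{n-1}$, $v_n=(1-n)r^n$ if $r=\rho$. Then the following are equivalent: (i) $[B,A]=\alpha+\epsilon A-A^2$; (ii) for all $n\in\mathbb N$, $(A+B)^n=\sum_{k=0}^n\binom{n}{k}(v_k+u_kA)B^{n-k}$; (iii) for all $t\in\mathbb K$, $e^{(A+B)t}=\Phi_A(t,r,\rho)e^{Bt}$.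
   Context: $\mathbb K\in\{\mathbb R,\mathbb C\}$ (taken as $\mathbb C$ here since the parameters are complex); scalars are identified with their multiples of $1_{\mathcal A}$; $[X,Y]=XY-YX$; $e^X=\sum_{n\ge0}X^n/n!$. For $A\in\mathcal A$ and $t,x,y$ scalars, \[ \Phi_A(t,x,y):=\begin{cases}\dfrac{ye^{xt}-xe^{yt}}{y-x}+A\dfrac{e^{yt}-e^{xt}}{y-x}& x\ne y,\\[4pt] (1-xt)e^{xt}+Ate^{xt}& x=y.\end{cases} \] Series are treated formally; identities in $t$ are equalities of formal power series in $t$ with coefficients in $\mathcal A$. *)

theory Defs
  imports
    Complex_Main
    "HOL-Computational_Algebra.Polynomial"
    "HOL-Computational_Algebra.Formal_Power_Series"
begin

text \<open>
  Associative unital complex algebras. The sort \<open>{ring, monoid_mult}\<close> is that of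
  rings with unit, without the requirement \<open>0 \<noteq> 1\<close> that is built into \<open>ring_1\<close>.
\<close>

locale complex_unital_algebra = vector_space scale
  for scale :: "complex \<Rightarrow> 'a::{ring, monoid_mult} \<Rightarrow> 'a" +
  assumes scale_mult_left: "scale c x * y = scale c (x * y)"
    and scale_mult_right: "x * scale c y = scale c (x * y)"

definition commutator :: "'a::ring \<Rightarrow> 'a \<Rightarrow> 'a" where
  "commutator X Y = X * Y - Y * X"

text \<open>
  Functions of \<open>t\<close> are formal power series in the indeterminate \<open>t\<close>, written \<open>fps_X\<close>.
  The series \<open>e\<^bsup>Xt\<^esup> = \<Sum>n. (Xt)\<^sup>n / n!\<close> has \<open>n\<close>-th coefficient \<open>X\<^sup>n / n!\<close>;
  \<open>fps_exp\<close> is not available for it because the algebra has no division.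
\<close>

definition alg_exp :: "(complex \<Rightarrow> 'a \<Rightarrow> 'a) \<Rightarrow> 'a::{ring, monoid_mult} \<Rightarrow> 'a fps" where
  "alg_exp scale X = Abs_fps (\<lambda>n. scale (1 / fact n) (X ^ n))"

text \<open>The identification of scalars with multiples of the unit, coefficientwise.\<close>

definition fps_scalar :: "(complex \<Rightarrow> 'a \<Rightarrow> 'a) \<Rightarrow> complex fps \<Rightarrow> 'a::{ring, monoid_mult} fps" where
  "fps_scalar scale f = Abs_fps (\<lambda>n. scale (fps_nth f n) 1)"

definition Phi ::
  "(complex \<Rightarrow> 'a \<Rightarrow> 'a) \<Rightarrow> 'a::{ring, monoid_mult} \<Rightarrow> complex \<Rightarrow> complex \<Rightarrow> 'a fps" where
  "Phi scale A x y =
    (if x \<noteq> y then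
       fps_scalar scale
         ((fps_const y * fps_exp x - fps_const x * fps_exp y) / fps_const (y - x))
       + fps_const A * fps_scalar scale ((fps_exp y - fps_exp x) / fps_const (y - x))
     else
       fps_scalar scale ((1 - fps_const x * fps_X) * fps_exp x)
       + fps_const A * fps_scalar scale (fps_X * fps_exp x))"

end

theory Submission
  imports Defs "HOL-Computational_Algebra.Fundamental_Theorem_Algebra"
begin

text \<open>
  Put \<open>w k = v k + u k A\<close>. The relation \<open>[B, A] = \<alpha> + \<epsilon> A - A\<^sup>2\<close> says \<open>(A + B) A = \<alpha> + \<epsilon> A + A B\<close>,
  which yields \<open>(A + B) w k = w (k + 1) + w k B\<close>. Iterating this rule is governed by Pascal's triangle,
  hence the binomial formula; the case \<open>n = 2\<close> of that formula gives the relation back.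
  The \<open>n\<close>-th coefficient of \<open>\<Phi>\<close> is \<open>w n / n!\<close>, so comparing coefficients turns the exponential
  identity into the binomial formula.
\<close>

text \<open>Over the complex numbers a polynomial is its leading coefficient, here
  \<open>-1\<close>, times the linear factors of its roots; comparing coefficients gives both
  equations. The multiset counts multiplicity, so a double root is covered.\<close>

lemma quadratic_proots_Vieta:
  fixes \<alpha> \<epsilon> r \<rho> :: complex
  assumes "proots [:\<alpha>, \<epsilon>, -1:] = {#r, \<rho>#}"
  shows "\<epsilon> = r + \<rho>" and "\<alpha> = - (r * \<rho>)"
proof -
  have "smult (-1) ([:-r, 1:] * [:-\<rho>, 1:]) = [:\<alpha>, \<epsilon>, -1:]"
    using complex_poly_decompose_multiset[of "[:\<alpha>, \<epsilon>, -1:]"] by (simp add: assms)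
  then show "\<epsilon> = r + \<rho>" and "\<alpha> = - (r * \<rho>)"
    by auto
qed

text \<open>Reduces every closed form or index shift below to two initial values and a check of the
  recurrence.\<close>

lemma linear_recurrence_2_unique:
  fixes f g :: "nat \<Rightarrow> 'b::comm_ring"
  assumes "f 0 = g 0" "f 1 = g 1"
    and "\<And>n. f (n + 2) = \<epsilon> * f (n + 1) + \<alpha> * f n"
    and "\<And>n. g (n + 2) = \<epsilon> * g (n + 1) + \<alpha> * g n"
  shows "f n = g n"
proof (induction n rule: induct_nat_012)
  case (ge2 n)
  then show ?case using assms(3,4)[of n] by simp
qed (use assms in simp_all)

lemma fps_nth_X_mult_exp:
  "fps_nth (fps_X * fps_exp x) n = of_nat n * x ^ (n - 1) / fact n" for x :: "'b::field_char_0"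
  by (cases n) (simp_all del: of_nat_Suc)

lemma fps_nth_double_root_exp:
  "fps_nth ((1 - fps_const x * fps_X) * fps_exp x) n = (1 - of_nat n) * x ^ n / fact n"
  for x :: "'b::field_char_0"
proof -
  have "(1 - fps_const x * fps_X) * fps_exp x = fps_exp x - fps_const x * (fps_X * fps_exp x)"
    by (simp add: algebra_simps)
  \<comment> \<open>At \<open>n = 0\<close> the exponent is truncated to \<open>0\<close>, but the
    factor \<open>of_nat n\<close> vanishes.\<close>
  moreover have "x * (of_nat n * x ^ (n - 1)) = of_nat n * x ^ n"
    by (cases n) simp_all
  ultimately show ?thesis
    by (simp only: fps_sub_nth fps_mult_left_const_nth fps_nth_X_mult_exp fps_exp_nth)
      (simp add: left_diff_distrib diff_divide_distrib)
qed

context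
  fixes \<alpha> \<epsilon> r \<rho> :: complex and u v :: "nat \<Rightarrow> complex"
  assumes Vieta: "\<epsilon> = r + \<rho>" "\<alpha> = - (r * \<rho>)"
    and u: "u 0 = 0" "u 1 = 1" "\<And>n. u (n + 2) = \<epsilon> * u (n + 1) + \<alpha> * u n"
    and v: "v 0 = 1" "v 1 = 0" "\<And>n. v (n + 2) = \<epsilon> * v (n + 1) + \<alpha> * v n"
begin

lemma u_distinct_roots: "u n = (\<rho> ^ n - r ^ n) / (\<rho> - r)" if "r \<noteq> \<rho>"
  by (rule linear_recurrence_2_unique[OF _ _ u(3)])
    (use that in \<open>simp_all add: u(1) u(2)[simplified] flip: add_divide_distrib\<close>,
      simp add: Vieta algebra_simps)

lemma v_distinct_roots: "v n = (\<rho> * r ^ n - r * \<rho> ^ n) / (\<rho> - r)" if "r \<noteq> \<rho>"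
  by (rule linear_recurrence_2_unique[OF _ _ v(3)])
    (use that in \<open>simp_all add: v(1) v(2)[simplified] flip: add_divide_distrib\<close>,
      simp add: Vieta algebra_simps)

lemma u_double_root: "u n = of_nat n * r ^ (n - 1)" if "r = \<rho>"
proof (rule linear_recurrence_2_unique[OF _ _ u(3)])
  fix n
  show "of_nat (n + 2) * r ^ (n + 2 - 1) =
      \<epsilon> * (of_nat (n + 1) * r ^ (n + 1 - 1)) + \<alpha> * (of_nat n * r ^ (n - 1))"
    by (cases n) (simp_all add: that Vieta algebra_simps)
qed (simp_all add: u(1) u(2)[simplified])

lemma v_double_root: "v n = (1 - of_nat n) * r ^ n" if "r = \<rho>"
  by (rule linear_recurrence_2_unique[OF _ _ v(3)])
    (simp_all add: v(1) v(2)[simplified] that Vieta algebra_simps)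

text \<open>Modulo \<open>X^2 = \<epsilon> * X + \<alpha>\<close> the power \<open>X^n\<close> is
  \<open>v n + u n * X\<close>. Multiplying once more by \<open>X\<close> gives this rule and
  \<open>u_Suc\<close>, the one-step form that the algebra computation needs.\<close>

lemma v_Suc: "v (Suc n) = \<alpha> * u n"
  by (rule linear_recurrence_2_unique[where \<epsilon> = \<epsilon> and \<alpha> = \<alpha>])
    (use u v(2) v(3)[of 0] v(1) v(3)[of "Suc n" for n] in \<open>simp_all add: algebra_simps\<close>)

lemma u_Suc: "u (Suc n) = v n + \<epsilon> * u n"
  by (cases n) (use u(1,2) v(1) u(3)[of "n - 1"] v_Suc[of "n - 1"] in \<open>simp_all add: algebra_simps\<close>)

end

context complex_unital_algebra
begin

text \<open>Left multiplication by \<open>S\<close> raises either the index of \<open>w\<close> or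
  the power of \<open>B\<close>, as in Pascal's triangle. Every \<open>w k\<close> stays to the left
  of \<open>B\<close>, so nothing has to commute.\<close>

lemma binomial_of_shift_rule:
  assumes "w 0 = 1" and shift: "\<And>k. S * w k = w (Suc k) + w k * B"
  shows "S ^ n = (\<Sum>k\<le>n. scale (of_nat (n choose k)) (w k * B ^ (n - k)))"
proof (induction n)
  case 0
  then show ?case using assms(1) by simp
next
  case (Suc n)
  let ?c = "\<lambda>n k. of_nat (n choose k) :: complex"
  have "S ^ Suc n = (\<Sum>k\<le>n. scale (?c n k) (S * w k * B ^ (n - k)))"
    by (simp add: Suc sum_distrib_left scale_mult_right mult.assoc)
  also have "\<dots> = (\<Sum>k\<le>n. scale (?c n k) (w (Suc k) * B ^ (n - k)))
      + (\<Sum>k\<le>n. scale (?c n k) (w k * B ^ (Suc n - k)))"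
    unfolding sum.distrib[symmetric]
    by (rule sum.cong) (auto simp: shift distrib_right mult.assoc scale_right_distrib Suc_diff_le)
  \<comment> \<open>The added term is zero because \<open>n choose Suc n = 0\<close>.\<close>
  also have "(\<Sum>k\<le>n. scale (?c n k) (w k * B ^ (Suc n - k)))
      = (\<Sum>k\<le>Suc n. scale (?c n k) (w k * B ^ (Suc n - k)))"
    by simp
  \<comment> \<open>Splitting off \<open>k = 0\<close> and shifting aligns this sum with the first
    one, so that Pascal's rule merges them.\<close>
  also have "\<dots> = w 0 * B ^ Suc n + (\<Sum>k\<le>n. scale (?c n (Suc k)) (w (Suc k) * B ^ (n - k)))"
    by (subst sum.atMost_Suc_shift) simp
  also have "(\<Sum>k\<le>n. scale (?c n k) (w (Suc k) * B ^ (n - k))) + \<dots>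
      = w 0 * B ^ Suc n + (\<Sum>k\<le>n. scale (?c (Suc n) (Suc k)) (w (Suc k) * B ^ (n - k)))"
    by (simp add: sum.distrib scale_left_distrib)
  also have "\<dots> = (\<Sum>k\<le>Suc n. scale (?c (Suc n) k) (w k * B ^ (Suc n - k)))"
    by (subst sum.atMost_Suc_shift) simp
  finally show ?case .
qed

lemma commutator_iff_binomial:
  assumes "u 0 = 0" "u 1 = 1" "v 0 = 1" "v 1 = 0"
    and v_Suc: "\<And>n. v (Suc n) = \<alpha> * u n" and u_Suc: "\<And>n. u (Suc n) = v n + \<epsilon> * u n"
  shows "commutator B A = scale \<alpha> 1 + scale \<epsilon> A - A ^ 2 \<longleftrightarrow>
    (\<forall>n. (A + B) ^ n =
      (\<Sum>k\<le>n. scale (of_nat (n choose k)) ((scale (v k) 1 + scale (u k) A) * B ^ (n - k))))"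
    (is "?comm \<longleftrightarrow> ?binom")
proof
  assume ?comm
  then have swap: "(A + B) * A = scale \<alpha> 1 + scale \<epsilon> A + A * B"
    by (simp add: commutator_def power2_eq_square algebra_simps)
  have "(A + B) * (scale (v k) 1 + scale (u k) A)
      = (scale (v (Suc k)) 1 + scale (u (Suc k)) A) + (scale (v k) 1 + scale (u k) A) * B" for k
  proof -
    have "(A + B) * (scale (v k) 1 + scale (u k) A)
        = scale (v k) (A + B) + scale (u k) ((A + B) * A)"
      by (simp add: distrib_left scale_mult_right)
    \<comment> \<open>The term \<open>A * B\<close> produced by \<open>swap\<close> joins
      \<open>scale (v k) B\<close> to form the summand ending in \<open>B\<close>.\<close>
    also have "\<dots> = (scale (v (Suc k)) 1 + scale (u (Suc k)) A) + (scale (v k) 1 + scale (u k) A) * B"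
      unfolding swap v_Suc u_Suc
      by (simp add: scale_mult_left distrib_right scale_right_distrib scale_left_distrib
          mult.commute[of _ "u k"] add_ac)
    finally show ?thesis .
  qed
  then show ?binom
    using assms(1,3) by (intro allI binomial_of_shift_rule) simp_all
next
  assume ?binom
  then have "(A + B) ^ 2 =
      (\<Sum>k\<le>2. scale (of_nat (2 choose k)) ((scale (v k) 1 + scale (u k) A) * B ^ (2 - k)))"
    by blast
  moreover have "u 2 = \<epsilon>" "v 2 = \<alpha>"
    using assms(1-4) v_Suc[of 1] u_Suc[of 1] by (simp_all add: numeral_2_eq_2)
  moreover have "scale 2 X = X + X" for X
    using scale_left_distrib[of 1 1 X] by simp
  \<comment> \<open>The coefficient pairs give \<open>1\<close>, \<open>A\<close> and
    \<open>\<alpha> + \<epsilon> A\<close> for \<open>k = 0, 1, 2\<close>. Cancelling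
    \<open>A * B + B * B\<close> leaves the commutator relation.\<close>
  ultimately have "A * A + A * B + B * A + B * B = B * B + (A * B + A * B) + (scale \<alpha> 1 + scale \<epsilon> A)"
    using assms(1-4) by (simp add: numeral_2_eq_2 algebra_simps)
  then show ?comm
    by (simp add: commutator_def power2_eq_square algebra_simps)
qed

text \<open>In the Cauchy product \<open>1 / (k! (n - k)!)\<close> equals
  \<open>(n choose k) / n!\<close>, and the common nonzero factor \<open>1 / n!\<close>
  cancels.\<close>

lemma exp_identity_iff_binomial:
  assumes "\<And>n. fps_nth F n = scale (1 / fact n) (w n)"
  shows "alg_exp scale S = F * alg_exp scale B \<longleftrightarrow>
    (\<forall>n. S ^ n = (\<Sum>k\<le>n. scale (of_nat (n choose k)) (w k * B ^ (n - k))))"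
proof -
  have "fps_nth (F * alg_exp scale B) n
      = scale (1 / fact n) (\<Sum>k\<le>n. scale (of_nat (n choose k)) (w k * B ^ (n - k)))" for n
    unfolding fps_mult_nth atLeast0AtMost scale_sum_right
    by (rule sum.cong)
      (simp_all add: assms alg_exp_def scale_mult_left scale_mult_right binomial_fact)
  then show ?thesis
    by (simp add: fps_eq_iff alg_exp_def)
qed

lemma Phi_nth:
  assumes "\<And>n. r \<noteq> \<rho> \<Longrightarrow> u n = (\<rho> ^ n - r ^ n) / (\<rho> - r)"
    and "\<And>n. r \<noteq> \<rho> \<Longrightarrow> v n = (\<rho> * r ^ n - r * \<rho> ^ n) / (\<rho> - r)"
    and "\<And>n. r = \<rho> \<Longrightarrow> u n = of_nat n * r ^ (n - 1)"
    and "\<And>n. r = \<rho> \<Longrightarrow> v n = (1 - of_nat n) * r ^ n"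
  shows "fps_nth (Phi scale A r \<rho>) n = scale (1 / fact n) (scale (v n) 1 + scale (u n) A)"
proof (cases "r = \<rho>")
  case True
  have "fps_nth ((1 - fps_const r * fps_X) * fps_exp r) n = v n / fact n"
    by (simp only: fps_nth_double_root_exp assms(4)[OF True])
  moreover have "fps_nth (fps_X * fps_exp r) n = u n / fact n"
    by (simp only: fps_nth_X_mult_exp assms(3)[OF True])
  ultimately show ?thesis
    using True by (simp add: Phi_def fps_scalar_def scale_mult_right scale_right_distrib)
next
  case False
  \<comment> \<open>Since \<open>\<rho> - r\<close> is nonzero, dividing by its constant series
    divides each coefficient.\<close>
  then have "fps_nth ((fps_const \<rho> * fps_exp r - fps_const r * fps_exp \<rho>) / fps_const (\<rho> - r)) n
      = v n / fact n"
    unfolding assms(2)[OF False] by (simp add: divide_inverse algebra_simps)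
  moreover have "fps_nth ((fps_exp \<rho> - fps_exp r) / fps_const (\<rho> - r)) n = u n / fact n"
    unfolding assms(1)[OF False] by (simp add: divide_inverse algebra_simps)
  ultimately show ?thesis
    using False by (simp add: Phi_def fps_scalar_def scale_mult_right scale_right_distrib)
qed

end

theorem theorem3p1:
  fixes scale :: "complex \<Rightarrow> 'a::{ring, monoid_mult} \<Rightarrow> 'a"
    and A B :: 'a and \<alpha> \<epsilon> r \<rho> :: complex and u v :: "nat \<Rightarrow> complex"
  assumes "complex_unital_algebra scale"
    and "\<alpha> \<noteq> 0 \<or> \<epsilon> \<noteq> 0"
    and "proots [:\<alpha>, \<epsilon>, -1:] = {#r, \<rho>#}"
    and "u 0 = 0" "u 1 = 1" "\<And>n. u (n + 2) = \<epsilon> * u (n + 1) + \<alpha> * u n"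
    and "v 0 = 1" "v 1 = 0" "\<And>n. v (n + 2) = \<epsilon> * v (n + 1) + \<alpha> * v n"
  shows "(r \<noteq> \<rho> \<longrightarrow>
      (\<forall>n. u n = (\<rho> ^ n - r ^ n) / (\<rho> - r) \<and>
           v n = (\<rho> * r ^ n - r * \<rho> ^ n) / (\<rho> - r))) \<and>
    (r = \<rho> \<longrightarrow>
      (\<forall>n. u n = of_nat n * r ^ (n - 1) \<and> v n = (1 - of_nat n) * r ^ n)) \<and>
    (commutator B A = scale \<alpha> 1 + scale \<epsilon> A - A ^ 2 \<longleftrightarrow>
      (\<forall>n. (A + B) ^ n =
        (\<Sum>k=0..n. scale (of_nat (n choose k)) ((scale (v k) 1 + scale (u k) A) * B ^ (n - k))))) \<and>
    (commutator B A = scale \<alpha> 1 + scale \<epsilon> A - A ^ 2 \<longleftrightarrow>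
      alg_exp scale (A + B) = Phi scale A r \<rho> * alg_exp scale B)"
proof -
  interpret complex_unital_algebra scale by fact
  note Vieta = quadratic_proots_Vieta[OF assms(3)]
  note closed_forms =
    u_distinct_roots[OF Vieta assms(4-9)] v_distinct_roots[OF Vieta assms(4-9)]
    u_double_root[OF Vieta assms(4-9)] v_double_root[OF Vieta assms(4-9)]
  note binom = commutator_iff_binomial[where u = u and v = v and \<alpha> = \<alpha> and \<epsilon> = \<epsilon>,
      OF assms(4,5,7,8) v_Suc[OF Vieta assms(4-9)] u_Suc[OF Vieta assms(4-9)]]
  have "fps_nth (Phi scale A r \<rho>) n = scale (1 / fact n) (scale (v n) 1 + scale (u n) A)" for n
    by (rule Phi_nth) (fact closed_forms)+
  note exp = exp_identity_iff_binomial[OF this]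
  \<comment> \<open>Both equivalences reduce to the same binomial formula: \<open>binom\<close>
    rewrites the commutator relation into it, \<open>exp\<close> the exponential identity.\<close>
  show ?thesis
    unfolding atLeast0AtMost binom exp using closed_forms by blast
qed

end
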